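(* For integers $m,n\geq 2$, $$\chi'_s(P_m\square P_n)=\begin{cases}3 & \text{if } m=n=2,\\ 4 & \text{if } (m=2,\ n\geq 3)\text{ or }(m\geq 3,\ n=2),\\ 5 & \text{if } (m\in\{3,4\},\ n=3)\text{ or }(m=3,\ n\in\{3,4\}),\\ 6 & \text{otherwise.}\end{cases}$$
   Context: $P_n$ is the path on $n$ vertices. A star edge coloring of a graph is a proper edge coloring such that no path or cycle with four edges uses at most two colors; the star chromatic index $\chi'_s(G)$ is the minimum number of colors in a star edge coloring of $G$. The Cartesian product $G\square H$ has vertex set $V(G)\times V(H)$, with $(a,x)(b,y)$ an edge iff either $ab\in E(G)$ and $x=y$, or $xy\in E(H)$ and $a=b$. *)

theory Defs
  imports Main
begin

record 'a ugraph =
  verts :: "'a set"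
  edges :: "'a set set"

definition path_graph :: "nat \<Rightarrow> nat ugraph" where
  "path_graph n = \<lparr> verts = {..<n}, edges = {{i, Suc i} | i. Suc i < n} \<rparr>"

definition cartesian_product :: "'a ugraph \<Rightarrow> 'b ugraph \<Rightarrow> ('a \<times> 'b) ugraph" (infixr "\<box>" 80) where
  "G \<box> H = \<lparr> verts = verts G \<times> verts H,
     edges = {{(a, x), (b, y)} | a b x y.
       (a, x) \<in> verts G \<times> verts H \<and> (b, y) \<in> verts G \<times> verts H \<and>
       ({a, b} \<in> edges G \<and> x = y \<or> {x, y} \<in> edges H \<and> a = b)} \<rparr>"

fun walk_edges :: "'a list \<Rightarrow> 'a set list" where
  "walk_edges (u # v # vs) = {u, v} # walk_edges (v # vs)"
| "walk_edges _ = []"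

text \<open>
  A path with k edges is given by its Suc k distinct vertices.  A cycle with k edges is given by
  its k distinct vertices; its closing edge joins the last vertex to the first one.
\<close>

definition is_path :: "'a ugraph \<Rightarrow> 'a list \<Rightarrow> bool" where
  "is_path G vs \<longleftrightarrow> vs \<noteq> [] \<and> distinct vs \<and> set vs \<subseteq> verts G \<and> set (walk_edges vs) \<subseteq> edges G"

definition cycle_edges :: "'a list \<Rightarrow> 'a set list" where
  "cycle_edges vs = walk_edges (vs @ [hd vs])"

definition is_cycle :: "'a ugraph \<Rightarrow> 'a list \<Rightarrow> bool" where
  "is_cycle G vs \<longleftrightarrow> length vs \<ge> 3 \<and> distinct vs \<and> set vs \<subseteq> verts G \<and>
     set (cycle_edges vs) \<subseteq> edges G"

definition proper_edge_coloring :: "'a ugraph \<Rightarrow> ('a set \<Rightarrow> 'c) \<Rightarrow> bool" where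
  "proper_edge_coloring G c \<longleftrightarrow>
     (\<forall>e \<in> edges G. \<forall>f \<in> edges G. e \<noteq> f \<and> e \<inter> f \<noteq> {} \<longrightarrow> c e \<noteq> c f)"

definition star_edge_coloring :: "'a ugraph \<Rightarrow> ('a set \<Rightarrow> 'c) \<Rightarrow> bool" where
  "star_edge_coloring G c \<longleftrightarrow> proper_edge_coloring G c \<and>
     (\<forall>vs. is_path G vs \<and> length (walk_edges vs) = 4 \<longrightarrow> \<not> card (c ` set (walk_edges vs)) \<le> 2) \<and>
     (\<forall>vs. is_cycle G vs \<and> length (cycle_edges vs) = 4 \<longrightarrow> \<not> card (c ` set (cycle_edges vs)) \<le> 2)"

text \<open>
  For a graph with finitely many edges some number of colors suffices, so the minimum exists.
\<close>

definition star_chromatic_index :: "'a ugraph \<Rightarrow> nat" where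
  "star_chromatic_index G =
     (LEAST k. \<exists>c :: 'a set \<Rightarrow> nat. star_edge_coloring G c \<and> c ` edges G \<subseteq> {..<k})"

end

theory Submission
  imports Defs
begin

text \<open>
  A star edge coloring is a proper vertex coloring of the line graph without a bicolored path on
  four vertices.  Such colorings pull back along locally injective graph homomorphisms, so the upper
  bounds follow from colorings of small quotients: the line graph of the infinite ladder is wrapped
  around with period 4, and that of the infinite grid is mapped to a circulant graph on 16 residues.
  They also restrict to subgrids, so the lower bounds reduce to \<open>P\<^sub>2 \<box> P\<^sub>2\<close>, \<open>P\<^sub>2 \<box> P\<^sub>3\<close>,
  \<open>P\<^sub>3 \<box> P\<^sub>3\<close>, \<open>P\<^sub>3 \<box> P\<^sub>5\<close> and \<open>P\<^sub>4 \<box> P\<^sub>4\<close>, where a backtracking search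
  (at most a few hundred nodes, for a good order of the edges) finds no coloring.
\<close>

section \<open>Star colorings of an abstract graph and their pullbacks\<close>

text \<open>The ends \<open>e\<close> and \<open>s\<close> may coincide: the walk is then a
  triangle, where properness already gives the second condition. Only entries two steps apart have
  to differ, which is what a locally injective map preserves.\<close>

definition star_coloring :: "'a set \<Rightarrow> ('a \<Rightarrow> 'a \<Rightarrow> bool) \<Rightarrow> ('a \<Rightarrow> 'c) \<Rightarrow> bool" where
  "star_coloring I adj C \<longleftrightarrow>
     (\<forall>e\<in>I. \<forall>f\<in>I. adj e f \<longrightarrow> C e \<noteq> C f) \<and>
     (\<forall>e\<in>I. \<forall>q\<in>I. \<forall>r\<in>I. \<forall>s\<in>I. adj e q \<and> adj q r \<and> adj r s \<and> e \<noteq> r \<and> q \<noteq> s \<longrightarrow>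
        \<not> (C e = C r \<and> C q = C s))"

definition star_colorable :: "'a set \<Rightarrow> ('a \<Rightarrow> 'a \<Rightarrow> bool) \<Rightarrow> nat \<Rightarrow> bool" where
  "star_colorable I adj k \<longleftrightarrow> (\<exists>C :: 'a \<Rightarrow> nat. star_coloring I adj C \<and> C ` I \<subseteq> {..<k})"

lemma star_coloringD1:
  "star_coloring I adj C \<Longrightarrow> e \<in> I \<Longrightarrow> f \<in> I \<Longrightarrow> adj e f \<Longrightarrow> C e \<noteq> C f"
  unfolding star_coloring_def by blast

lemma star_coloringD2:
  "star_coloring I adj C \<Longrightarrow> {e, q, r, s} \<subseteq> I \<Longrightarrow> adj e q \<Longrightarrow> adj q r \<Longrightarrow> adj r s \<Longrightarrow>
    e \<noteq> r \<Longrightarrow> q \<noteq> s \<Longrightarrow> \<not> (C e = C r \<and> C q = C s)"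
  unfolding star_coloring_def by blast

text \<open>The image of a walk under \<open>p\<close> is a walk, and \<open>loc_inj\<close> keeps
  its entries at distance two apart. Its ends may become equal, which \<open>star_coloring\<close>
  tolerates.\<close>

lemma star_coloring_pullback:
  assumes star: "star_coloring J adj' C"
    and maps: "\<And>e. e \<in> I \<Longrightarrow> p e \<in> J"
    and adj: "\<And>e f. e \<in> I \<Longrightarrow> f \<in> I \<Longrightarrow> adj e f \<Longrightarrow> adj' (p e) (p f)"
    and loc_inj: "\<And>e q r. e \<in> I \<Longrightarrow> q \<in> I \<Longrightarrow> r \<in> I \<Longrightarrow> adj e q \<Longrightarrow> adj q r \<Longrightarrow> e \<noteq> r \<Longrightarrow> p e \<noteq> p r"
  shows "star_coloring I adj (C \<circ> p)"
  unfolding star_coloring_def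
proof (intro conjI ballI impI)
  fix e f assume "e \<in> I" "f \<in> I" "adj e f"
  then show "(C \<circ> p) e \<noteq> (C \<circ> p) f"
    using star_coloringD1[OF star maps maps adj] by simp
next
  fix e q r s
  assume I: "e \<in> I" "q \<in> I" "r \<in> I" "s \<in> I"
    and "adj e q \<and> adj q r \<and> adj r s \<and> e \<noteq> r \<and> q \<noteq> s"
  then have "adj' (p e) (p q)" "adj' (p q) (p r)" "adj' (p r) (p s)" "p e \<noteq> p r" "p q \<noteq> p s"
    using adj loc_inj by blast+
  then show "\<not> ((C \<circ> p) e = (C \<circ> p) r \<and> (C \<circ> p) q = (C \<circ> p) s)"
    using star_coloringD2[OF star, of "p e" "p q" "p r" "p s"] maps I by simp
qed

lemma star_colorable_pullback:
  assumes "star_colorable J adj' k"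
    and "\<And>e. e \<in> I \<Longrightarrow> p e \<in> J"
    and "\<And>e f. e \<in> I \<Longrightarrow> f \<in> I \<Longrightarrow> adj e f \<Longrightarrow> adj' (p e) (p f)"
    and "\<And>e q r. e \<in> I \<Longrightarrow> q \<in> I \<Longrightarrow> r \<in> I \<Longrightarrow> adj e q \<Longrightarrow> adj q r \<Longrightarrow> e \<noteq> r \<Longrightarrow> p e \<noteq> p r"
  shows "star_colorable I adj k"
proof -
  obtain C :: "'a \<Rightarrow> nat" where C: "star_coloring J adj' C" "C ` J \<subseteq> {..<k}"
    using assms(1) unfolding star_colorable_def by blast
  have "star_coloring I adj (C \<circ> p)"
    using C(1) assms(2-4) by (rule star_coloring_pullback)
  moreover have "(C \<circ> p) ` I \<subseteq> {..<k}"
    using C(2) assms(2) by auto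
  ultimately show ?thesis
    unfolding star_colorable_def by blast
qed

lemma star_colorable_subset:
  "star_colorable J adj k \<Longrightarrow> I \<subseteq> J \<Longrightarrow> star_colorable I adj k"
  by (erule star_colorable_pullback[where p = id]) auto

lemma star_colorable_mono:
  "star_colorable I adj k \<Longrightarrow> k \<le> l \<Longrightarrow> star_colorable I adj l"
  unfolding star_colorable_def by (meson lessThan_subset_iff order_trans)

section \<open>Star edge colorings as star colorings of the line graph\<close>

definition meets :: "'a set \<Rightarrow> 'a set \<Rightarrow> bool" where
  "meets e f \<longleftrightarrow> e \<noteq> f \<and> e \<inter> f \<noteq> {}"

lemma length_walk_edges: "length (walk_edges vs) = length vs - 1"
  by (induction vs rule: walk_edges.induct) auto

lemma star_edge_coloring_iff:
  assumes "\<And>e. e \<in> edges G \<Longrightarrow> e \<subseteq> verts G \<and> card e = 2"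
  shows "star_edge_coloring G c \<longleftrightarrow> star_coloring (edges G) meets c"
proof
  assume star: "star_edge_coloring G c"
  have proper: "c e \<noteq> c f" if "e \<in> edges G" "f \<in> edges G" "meets e f" for e f
    using star that unfolding star_edge_coloring_def proper_edge_coloring_def meets_def by blast
  have False
    if E: "e \<in> edges G" "q \<in> edges G" "r \<in> edges G" "s \<in> edges G"
      and eq: "meets e q" and qr: "meets q r" and rs: "meets r s" and ne: "e \<noteq> r" "q \<noteq> s"
      and col: "c e = c r" "c q = c s" for e q r s
  proof -
    \<comment> \<open>Edges of equal color do not meet. This disjointness makes the common vertices
      \<open>y\<close>, \<open>z\<close>, \<open>w\<close> distinct, so the four edges form a path,
      or a cycle if its two ends agree.\<close>
    have er: "e \<inter> r = {}" and qs: "q \<inter> s = {}"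
      using proper E ne col unfolding meets_def by blast+
    obtain y where y: "y \<in> e" "y \<in> q"
      using eq unfolding meets_def by blast
    obtain z where z: "z \<in> q" "z \<in> r"
      using qr unfolding meets_def by blast
    obtain w where w: "w \<in> r" "w \<in> s"
      using rs unfolding meets_def by blast
    have other: "\<exists>b. f = {a, b} \<and> a \<noteq> b" if "f \<in> edges G" "a \<in> f" for f a
      using assms[OF that(1)] that(2) by (auto simp: card_2_iff)
    obtain x where x: "e = {x, y}" "x \<noteq> y"
      using other[OF E(1) y(1)] by blast
    obtain v where v: "s = {w, v}" "w \<noteq> v"
      using other[OF E(4) w(2)] by blast
    have q: "q = {y, z}" "y \<noteq> z"
      using other[OF E(2) y(2)] y z er by blast+
    have r: "r = {z, w}" "z \<noteq> w"
      using other[OF E(3) z(2)] z w qs by blast+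
    have V: "{x, y, z, w, v} \<subseteq> verts G"
      using assms E x q r v by blast
    have card: "card {c e, c q, c r, c s} \<le> 2"
      using col by (simp add: card_insert_if)
    show False
    proof (cases "v = x")
      case True
      have "is_cycle G [x, y, z, w]" "length (cycle_edges [x, y, z, w]) = 4"
        using True V E x q r v er qs by (auto simp: is_cycle_def cycle_edges_def insert_commute)
      moreover have "c ` set (cycle_edges [x, y, z, w]) = {c e, c q, c r, c s}"
        using True x q r v by (simp add: cycle_edges_def insert_commute)
      ultimately show False
        using star card unfolding star_edge_coloring_def by metis
    next
      case False
      have "is_path G [x, y, z, w, v]" "length (walk_edges [x, y, z, w, v]) = 4"
        using False V E x q r v er qs by (auto simp: is_path_def)
      moreover have "c ` set (walk_edges [x, y, z, w, v]) = {c e, c q, c r, c s}"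
        using x q r v by simp
      ultimately show False
        using star card unfolding star_edge_coloring_def by metis
    qed
  qed
  then show "star_coloring (edges G) meets c"
    unfolding star_coloring_def using proper by blast
next
  assume star: "star_coloring (edges G) meets c"
  have proper: "proper_edge_coloring G c"
    unfolding proper_edge_coloring_def using star_coloringD1[OF star] by (simp add: meets_def)
  \<comment> \<open>Consecutive edges have different colors, so two colors on four edges could only
    alternate.\<close>
  have bicolored: "2 < card {c e, c q, c r, c s}"
    if "{e, q, r, s} \<subseteq> edges G" "meets e q" "meets q r" "meets r s" "e \<noteq> r" "q \<noteq> s" for e q r s
  proof -
    have "c e \<noteq> c q" "c q \<noteq> c r" "c r \<noteq> c s"
      using star_coloringD1[OF star] that by auto
    moreover have "\<not> (c e = c r \<and> c q = c s)"
      using star_coloringD2[OF star] that by blast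
    ultimately show ?thesis
      by (auto simp: card_insert_if)
  qed
  have "\<not> card (c ` set (walk_edges vs)) \<le> 2"
    if path: "is_path G vs" and len: "length (walk_edges vs) = 4" for vs
  proof -
    have "length vs = 5"
      using len by (simp add: length_walk_edges)
    then obtain x y z w v where vs: "vs = [x, y, z, w, v]"
      by (auto simp: length_Suc_conv numeral_eq_Suc)
    have "2 < card {c {x, y}, c {y, z}, c {z, w}, c {w, v}}"
      using path unfolding vs is_path_def by (intro bicolored) (auto simp: meets_def doubleton_eq_iff)
    then show ?thesis
      by (simp add: vs)
  qed
  moreover have "\<not> card (c ` set (cycle_edges vs)) \<le> 2"
    if cycle: "is_cycle G vs" and len: "length (cycle_edges vs) = 4" for vs
  proof -
    have "length vs = 4"
      using len by (simp add: cycle_edges_def length_walk_edges)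
    then obtain x y z w where vs: "vs = [x, y, z, w]"
      by (auto simp: length_Suc_conv numeral_eq_Suc)
    have "2 < card {c {x, y}, c {y, z}, c {z, w}, c {w, x}}"
      using cycle unfolding vs is_cycle_def cycle_edges_def
      by (intro bicolored) (auto simp: meets_def doubleton_eq_iff)
    then show ?thesis
      by (simp add: vs cycle_edges_def)
  qed
  ultimately show "star_edge_coloring G c"
    unfolding star_edge_coloring_def using proper by blast
qed

section \<open>The line graph of the grid in doubled coordinates\<close>

text \<open>
  The edge between \<open>(i, j)\<close> and \<open>(i', j')\<close> is encoded by its doubled midpoint \<open>(i + i', j + j')\<close>,
  which has exactly one odd coordinate.
\<close>

definition grid_edges :: "nat \<Rightarrow> nat \<Rightarrow> (nat \<times> nat) set" where
  "grid_edges m n = {(x, y). odd (x + y) \<and> Suc x < 2 * m \<and> Suc y < 2 * n}"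

fun edge_at :: "nat \<times> nat \<Rightarrow> (nat \<times> nat) set" where
  "edge_at (x, y) = {(x div 2, y div 2), (Suc x div 2, Suc y div 2)}"

text \<open>Midpoints of perpendicular edges with a common vertex differ by one in both coordinates;
  those of collinear ones differ by two along the edge. The parity guards exclude opposite sides of
  a unit square, which are also two apart but across the edge direction.\<close>

fun grid_adj :: "nat \<times> nat \<Rightarrow> nat \<times> nat \<Rightarrow> bool" where
  "grid_adj (x, y) (x', y') \<longleftrightarrow>
     (x = Suc x' \<or> x' = Suc x) \<and> (y = Suc y' \<or> y' = Suc y) \<or>
     odd x \<and> y = y' \<and> (x = x' + 2 \<or> x' = x + 2) \<or>
     odd y \<and> x = x' \<and> (y = y' + 2 \<or> y' = y + 2)"

lemma parity_pair_cases:
  assumes "odd (x + y)"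
  obtains i j where "x = Suc (2 * i)" "y = 2 * j" | i j where "x = 2 * i" "y = Suc (2 * j)"
  using assms by (cases "odd x") (auto elim!: oddE evenE)

lemma edges_grid:
  "edges (path_graph m \<box> path_graph n) = edge_at ` grid_edges m n"
proof (intro equalityI subsetI)
  fix e assume "e \<in> edges (path_graph m \<box> path_graph n)"
  then consider
      i y where "e = {(i, y), (Suc i, y)}" "Suc i < m" "y < n"
    | a j where "e = {(a, j), (a, Suc j)}" "a < m" "Suc j < n"
    by (fastforce simp: cartesian_product_def path_graph_def doubleton_eq_iff insert_commute)
  then show "e \<in> edge_at ` grid_edges m n"
  proof cases
    case (1 i y)
    then show ?thesis
      by (intro image_eqI[of _ _ "(Suc (2 * i), 2 * y)"]) (auto simp: grid_edges_def)
  next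
    case (2 a j)
    then show ?thesis
      by (intro image_eqI[of _ _ "(2 * a, Suc (2 * j))"]) (auto simp: grid_edges_def)
  qed
next
  fix e assume "e \<in> edge_at ` grid_edges m n"
  then obtain x y where e: "e = edge_at (x, y)" and xy: "odd (x + y)" "Suc x < 2 * m" "Suc y < 2 * n"
    by (auto simp: grid_edges_def simp del: edge_at.simps)
  have horizontal: "{(i, j), (Suc i, j)} \<in> edges (path_graph m \<box> path_graph n)"
    if "Suc i < m" "j < n" for i j
    unfolding cartesian_product_def path_graph_def ugraph.simps mem_Collect_eq
    by (rule exI[of _ i], rule exI[of _ "Suc i"], rule exI[of _ j], rule exI[of _ j])
      (use that in auto)
  have vertical: "{(i, j), (i, Suc j)} \<in> edges (path_graph m \<box> path_graph n)"
    if "i < m" "Suc j < n" for i j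
    unfolding cartesian_product_def path_graph_def ugraph.simps mem_Collect_eq
    by (rule exI[of _ i], rule exI[of _ i], rule exI[of _ j], rule exI[of _ "Suc j"])
      (use that in auto)
  from xy(1) show "e \<in> edges (path_graph m \<box> path_graph n)"
    by (cases rule: parity_pair_cases) (use xy in \<open>auto simp: e intro: horizontal vertical\<close>)
qed

lemma edge_at_eq_iff:
  "odd (x + y) \<Longrightarrow> odd (x' + y') \<Longrightarrow> edge_at (x, y) = edge_at (x', y') \<longleftrightarrow> x = x' \<and> y = y'"
  by (elim parity_pair_cases) (auto simp: doubleton_eq_iff)

lemma double_eq_Suc_double:
  "2 * i \<noteq> Suc (2 * j)" "Suc (2 * j) \<noteq> 2 * i" "2 * i = Suc (Suc (2 * j)) \<longleftrightarrow> i = Suc j" for i j :: nat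
  by presburger+

lemma meets_edge_at_iff:
  assumes "odd (x + y)" and "odd (x' + y')"
  shows "meets (edge_at (x, y)) (edge_at (x', y')) \<longleftrightarrow> grid_adj (x, y) (x', y')"
  unfolding meets_def edge_at_eq_iff[OF assms]
  using assms by (elim parity_pair_cases) (simp_all add: double_eq_Suc_double, (metis n_not_Suc_n)+)

lemma meets_edge_at_grid:
  "e \<in> grid_edges m n \<Longrightarrow> f \<in> grid_edges m n \<Longrightarrow> meets (edge_at e) (edge_at f) \<longleftrightarrow> grid_adj e f"
  by (cases e; cases f) (auto simp: grid_edges_def meets_edge_at_iff simp del: edge_at.simps grid_adj.simps)

lemma grid_simple:
  assumes "e \<in> edges (path_graph m \<box> path_graph n)"
  shows "e \<subseteq> verts (path_graph m \<box> path_graph n) \<and> card e = 2"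
  using assms by (auto simp: cartesian_product_def path_graph_def card_insert_if doubleton_eq_iff)

lemma star_colorable_grid_iff:
  "star_colorable (edges (path_graph m \<box> path_graph n)) meets k \<longleftrightarrow>
   star_colorable (grid_edges m n) grid_adj k"
proof
  assume "star_colorable (edges (path_graph m \<box> path_graph n)) meets k"
  then show "star_colorable (grid_edges m n) grid_adj k"
    by (rule star_colorable_pullback[where p = edge_at])
      (auto simp: edges_grid grid_edges_def meets_edge_at_iff edge_at_eq_iff simp del: edge_at.simps grid_adj.simps)
next
  have inj: "inj_on edge_at (grid_edges m n)"
    by (auto simp: inj_on_def grid_edges_def edge_at_eq_iff simp del: edge_at.simps)
  assume "star_colorable (grid_edges m n) grid_adj k"
  then show "star_colorable (edges (path_graph m \<box> path_graph n)) meets k"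
    by (rule star_colorable_pullback[where p = "inv_into (grid_edges m n) edge_at"])
      (auto simp: edges_grid inv_into_f_f[OF inj] meets_edge_at_grid simp del: edge_at.simps grid_adj.simps)
qed

lemma star_chromatic_index_grid:
  "star_chromatic_index (path_graph m \<box> path_graph n) = (LEAST k. star_colorable (grid_edges m n) grid_adj k)"
  unfolding star_chromatic_index_def star_colorable_grid_iff[symmetric]
  unfolding star_colorable_def
  by (simp add: star_edge_coloring_iff[of "path_graph m \<box> path_graph n"] grid_simple)

section \<open>Backtracking search and lower bounds\<close>

type_synonym constraints = "nat list \<times> (nat \<times> nat \<times> nat) list"

text \<open>
  For the edge with index \<open>i\<close>, against the edges of smaller index: its color differs from that of
  each \<open>j\<close> in the first list, and from that of \<open>r\<close> for each \<open>(r, q, s)\<close> in the second list such that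
  \<open>q\<close> and \<open>s\<close> have the same color.
\<close>

definition constraints_at :: "('a \<Rightarrow> 'a \<Rightarrow> bool) \<Rightarrow> 'a list \<Rightarrow> nat \<Rightarrow> constraints" where
  "constraints_at adj es i =
     (filter (\<lambda>j. adj (es ! i) (es ! j)) [0..<i],
      [(r, q, s). q \<leftarrow> [0..<i], adj (es ! i) (es ! q), r \<leftarrow> [0..<i], adj (es ! q) (es ! r),
         s \<leftarrow> [0..<i], s \<noteq> q, adj (es ! r) (es ! s) \<or> adj (es ! i) (es ! s)])"

text \<open>The bounds on the indices ensure that the lookups in \<open>cs\<close> during the search
  only reach colors already assigned.\<close>

fun obeys :: "(nat \<Rightarrow> nat) \<Rightarrow> nat \<Rightarrow> constraints \<Rightarrow> bool" where
  "obeys f i (A, Q) \<longleftrightarrow>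
     (\<forall>j\<in>set A. j < i \<and> f i \<noteq> f j) \<and>
     (\<forall>(r, q, s)\<in>set Q. r < i \<and> q < i \<and> s < i \<and> \<not> (f i = f r \<and> f q = f s))"

text \<open>
  The colors in use are always those below \<open>m\<close>, and only the first unused color is tried as
  a new one: an arbitrary coloring can be renamed to obey this.
\<close>

fun extendable :: "nat \<Rightarrow> constraints list \<Rightarrow> nat \<Rightarrow> nat list \<Rightarrow> bool" where
  "extendable k [] m cs = True"
| "extendable k ((A, Q) # T) m cs =
     (let F = map (\<lambda>j. cs ! j) A @ map (\<lambda>(r, q, s). cs ! r) (filter (\<lambda>(r, q, s). cs ! q = cs ! s) Q)
      in list_ex (\<lambda>x. x \<notin> set F \<and> extendable k T (max m (Suc x)) (cs @ [x])) [0..<min k (Suc m)])"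

definition search :: "('a \<Rightarrow> 'a \<Rightarrow> bool) \<Rightarrow> 'a list \<Rightarrow> nat \<Rightarrow> bool" where
  "search adj es k = extendable k (map (constraints_at adj es) [0..<length es]) 0 []"

lemma obeys_rename:
  assumes "\<And>i j. g i = g j \<longleftrightarrow> f i = f j"
  shows "obeys g i c = obeys f i c"
  by (cases c) (simp add: assms)

text \<open>Completeness of the search: it can follow any valid \<open>f\<close>, up to renaming
  colors. The induction generalizes over \<open>f\<close>, since each new color may force another
  renaming.\<close>

lemma extendableI:
  assumes "\<And>i. i < length T \<Longrightarrow> obeys f (l + i) (T ! i)"
    and "\<And>i. i < l \<Longrightarrow> f i < m" and "m \<le> k" and "\<And>i. i < l + length T \<Longrightarrow> f i < k"
  shows "extendable k T m (map f [0..<l])"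
  using assms
proof (induction T arbitrary: f l m)
  case Nil
  then show ?case by simp
next
  case (Cons c T)
  obtain A Q where c: "c = (A, Q)"
    by (cases c)
  have "\<exists>g. g l \<le> m \<and> (\<forall>i<l. g i = f i) \<and> (\<forall>i j. g i = g j \<longleftrightarrow> f i = f j) \<and> (\<forall>i<l + length (c # T). g i < k)"
  proof (cases "f l \<le> m")
    case True
    then show ?thesis using Cons.prems by (intro exI[of _ f]) auto
  next
    case False
    \<comment> \<open>The transposition of the colors \<open>m\<close> and \<open>f l\<close>. The
      prefix uses only colors below \<open>m\<close>, and \<open>f l > m\<close> here, so its colors
      stay fixed.\<close>
    define g where "g i = (if f i = m then f l else if f i = f l then m else f i)" for i
    have "f l < k"
      using Cons.prems(4)[of l] by simp
    have "g l \<le> m"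
      by (simp add: g_def)
    moreover have "g i = f i" if "i < l" for i
      using Cons.prems(2)[OF that] False by (simp add: g_def)
    moreover have "g i = g j \<longleftrightarrow> f i = f j" for i j
      by (auto simp: g_def)
    moreover have "g i < k" if "i < l + length (c # T)" for i
      using Cons.prems(4)[OF that] False \<open>f l < k\<close> by (simp add: g_def)
    ultimately show ?thesis
      by blast
  qed
  then obtain g where g: "g l \<le> m" "\<And>i. i < l \<Longrightarrow> g i = f i" "\<And>i j. g i = g j \<longleftrightarrow> f i = f j"
      "\<And>i. i < l + length (c # T) \<Longrightarrow> g i < k"
    by blast
  have resp: "obeys g (l + i) ((c # T) ! i)" if "i < length (c # T)" for i
    using Cons.prems(1)[OF that] obeys_rename[of g f] g(3) by simp
  have "g l < k"
    using g(4)[of l] by simp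
  have ext: "extendable k T (max m (Suc (g l))) (map g [0..<Suc l])"
  proof (rule Cons.IH)
    show "obeys g (Suc l + i) (T ! i)" if "i < length T" for i
      using resp[of "Suc i"] that by simp
    show "g i < max m (Suc (g l))" if "i < Suc l" for i
      using that Cons.prems(2)[of i] g(2)[of i] by (cases "i = l") auto
    show "max m (Suc (g l)) \<le> k"
      using \<open>m \<le> k\<close> \<open>g l < k\<close> by simp
    show "g i < k" if "i < Suc l + length T" for i
      using g(4) that by simp
  qed
  have "obeys g l (A, Q)"
    using resp[of 0] c by simp
  then have new: "g l \<notin> set (map (\<lambda>j. map g [0..<l] ! j) A @ map (\<lambda>(r, q, s). map g [0..<l] ! r)
      (filter (\<lambda>(r, q, s). map g [0..<l] ! q = map g [0..<l] ! s) Q))"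
    by fastforce
  have eq: "map f [0..<l] = map g [0..<l]"
    using g(2) by simp
  have step: "extendable k ((A, Q) # T) m cs"
    if "extendable k T (max m (Suc x)) (cs @ [x])" "x \<le> m" "x < k"
      "x \<notin> set (map (\<lambda>j. cs ! j) A @ map (\<lambda>(r, q, s). cs ! r) (filter (\<lambda>(r, q, s). cs ! q = cs ! s) Q))"
    for cs x
    using that unfolding extendable.simps Let_def list_ex_iff
    by (intro bexI[of _ x]) simp_all
  show ?case
    unfolding c eq by (rule step[OF _ g(1) \<open>g l < k\<close> new]) (use ext in simp)
qed

lemma searchI:
  assumes "star_colorable I adj k" and "set es \<subseteq> I" and "distinct es"
    and sym: "\<And>e f. adj e f \<Longrightarrow> adj f e"
  shows "search adj es k"
proof -
  obtain C :: "'a \<Rightarrow> nat" where C: "star_coloring I adj C" "C ` I \<subseteq> {..<k}"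
    using assms(1) unfolding star_colorable_def by blast
  let ?f = "\<lambda>i. C (es ! i)"
  have I: "es ! i \<in> I" if "i < length es" for i
    using assms(2) that by auto
  have "obeys ?f i (constraints_at adj es i)" if i: "i < length es" for i
  proof -
    have "\<not> (?f i = ?f r \<and> ?f q = ?f s)"
      if "q < i" "r < i" "s < i" "adj (es ! i) (es ! q)" "adj (es ! q) (es ! r)" "s \<noteq> q"
        and s: "adj (es ! r) (es ! s) \<or> adj (es ! i) (es ! s)" for r q s
    proof -
      have ne: "es ! i \<noteq> es ! r" "es ! q \<noteq> es ! s"
        using that i \<open>distinct es\<close> by (auto simp: nth_eq_iff_index_eq)
      \<comment> \<open>The edge placed last is an end of the walk \<open>i, q, r, s\<close> or an
        inner entry of the walk \<open>r, q, i, s\<close>; by symmetry of \<open>adj\<close> no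
        other position arises.\<close>
      have sub: "{es ! i, es ! q, es ! r, es ! s} \<subseteq> I" "{es ! r, es ! q, es ! i, es ! s} \<subseteq> I"
        using I i that by auto
      from s show ?thesis
        using star_coloringD2[OF C(1) sub(1)] star_coloringD2[OF C(1) sub(2)] that sym ne by metis
    qed
    moreover have "?f i \<noteq> ?f j" if "j < i" "adj (es ! i) (es ! j)" for j
      using star_coloringD1[OF C(1)] I i that by simp
    ultimately show ?thesis
      by (auto simp: constraints_at_def)
  qed
  moreover have "?f i < k" if "i < length es" for i
    using C(2) I that by blast
  ultimately show ?thesis
    using extendableI[of "map (constraints_at adj es) [0..<length es]" ?f 0 0 k]
    by (simp add: search_def)
qed

lemma grid_adj_sym: "grid_adj e f \<Longrightarrow> grid_adj f e"
  by (cases e; cases f; simp only: grid_adj.simps; elim disjE conjE) simp_all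

text \<open>The list may omit edges: below, 14 of the 22 edges of the 3 x 5 grid and 18 of the 24
  edges of the 4 x 4 grid suffice. From the 3 x 3 grid on, each list starts with the four edges at
  the vertex (1, 1); they meet pairwise, so the search has a single choice for their colors.\<close>

lemma grid_not_colorable:
  assumes "\<not> search grid_adj es k" and "distinct es" and "list_all (\<lambda>e. e \<in> grid_edges m n) es"
  shows "\<not> star_colorable (grid_edges m n) grid_adj k"
  using searchI[of "grid_edges m n" grid_adj k es] assms grid_adj_sym by (auto simp: list_all_iff)

lemma not_colorable_2_2: "\<not> star_colorable (grid_edges 2 2) grid_adj 2"
proof (rule grid_not_colorable)
  show "\<not> search grid_adj [(1, 2), (2, 1), (0, 1), (1, 0)] 2"
    by code_simp
qed (auto simp: grid_edges_def)

lemma not_colorable_2_3: "\<not> star_colorable (grid_edges 2 3) grid_adj 3"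
proof (rule grid_not_colorable)
  show "\<not> search grid_adj [(1, 2), (2, 1), (2, 3), (1, 0), (0, 1)] 3"
    by code_simp
qed (auto simp: grid_edges_def)

lemma not_colorable_3_3: "\<not> star_colorable (grid_edges 3 3) grid_adj 4"
proof (rule grid_not_colorable)
  show "\<not> search grid_adj [(2, 1), (1, 2), (2, 3), (3, 2), (0, 3), (1, 4), (3, 4), (4, 3), (4, 1),
      (3, 0), (1, 0)] 4"
    by code_simp
qed (auto simp: grid_edges_def)

lemma not_colorable_3_5: "\<not> star_colorable (grid_edges 3 5) grid_adj 5"
proof (rule grid_not_colorable)
  show "\<not> search grid_adj [(2, 1), (2, 3), (1, 2), (3, 2), (1, 4), (0, 3), (0, 5), (2, 5), (1, 6),
      (2, 7), (3, 6), (3, 4), (4, 5), (4, 3)] 5"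
    by code_simp
qed (auto simp: grid_edges_def)

lemma not_colorable_4_4: "\<not> star_colorable (grid_edges 4 4) grid_adj 5"
proof (rule grid_not_colorable)
  show "\<not> search grid_adj [(3, 2), (2, 3), (1, 2), (2, 1), (3, 4), (4, 3), (5, 4), (4, 5), (1, 4),
      (0, 3), (0, 5), (2, 5), (3, 6), (1, 6), (0, 1), (1, 0), (5, 2), (4, 1)] 5"
    by code_simp
qed (auto simp: grid_edges_def)

section \<open>Upper bounds from finite checks\<close>

text \<open>The nested filters keep evaluation small: only walks are followed, and a fourth entry is
  sought only once \<open>C e = C r\<close>.\<close>

definition star_check :: "'a list \<Rightarrow> ('a \<Rightarrow> 'a \<Rightarrow> bool) \<Rightarrow> ('a \<Rightarrow> nat) \<Rightarrow> nat \<Rightarrow> bool" where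
  "star_check J adj C k \<longleftrightarrow> list_all (\<lambda>q. C q < k \<and>
     list_all (\<lambda>e. C e \<noteq> C q \<and>
       list_all (\<lambda>r. list_all (\<lambda>s. C q \<noteq> C s) (filter (\<lambda>s. q \<noteq> s \<and> adj r s) J))
         (filter (\<lambda>r. C e = C r) (filter (\<lambda>r. e \<noteq> r \<and> adj q r) J)))
       (filter (\<lambda>e. adj e q) J)) J"

lemma star_colorable_check:
  assumes "star_check J adj C k"
  shows "star_colorable (set J) adj k"
proof -
  have check: "C q < k" "adj e q \<Longrightarrow> C e \<noteq> C q"
      "adj e q \<Longrightarrow> adj q r \<Longrightarrow> adj r s \<Longrightarrow> e \<noteq> r \<Longrightarrow> q \<noteq> s \<Longrightarrow> C e = C r \<Longrightarrow> C q \<noteq> C s"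
    if "e \<in> set J" "q \<in> set J" "r \<in> set J" "s \<in> set J" for e q r s
    using assms that unfolding star_check_def list_all_iff set_filter by blast+
  have "star_coloring (set J) adj C"
    unfolding star_coloring_def using check(2,3) by blast
  moreover have "C ` set J \<subseteq> {..<k}"
    using check(1) by blast
  ultimately show ?thesis
    unfolding star_colorable_def by blast
qed

lemma colorable_2_2: "star_colorable (grid_edges 2 2) grid_adj 3"
proof -
  \<comment> \<open>The coloring \<open>fst\<close> repeats a color only on the opposite sides (1,
    0) and (1, 2) of the square.\<close>
  have "star_check [(0, 1), (1, 0), (1, 2), (2, 1)] grid_adj fst 3"
    by code_simp
  moreover have "grid_edges 2 2 \<subseteq> set [(0, 1), (1, 0), (1, 2), (2, 1)]"
    by (auto simp: grid_edges_def) presburger+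
  ultimately show ?thesis
    using star_colorable_check star_colorable_subset by blast
qed

text \<open>Row \<open>x\<close> lists the edges with first coordinate \<open>x\<close>; their
  \<open>y\<close> all have the parity opposite to \<open>x\<close>, so \<open>y div 2\<close>
  numbers them consecutively.\<close>

definition table_3_4 :: "nat \<times> nat \<Rightarrow> nat" where
  "table_3_4 = (\<lambda>(x, y). [[1, 0, 2], [0, 2, 3, 1], [3, 4, 0], [2, 1, 2, 4], [4, 0, 1]] ! x ! (y div 2))"

lemma colorable_3_4: "star_colorable (grid_edges 3 4) grid_adj 5"
proof -
  let ?J = "filter (\<lambda>(x, y). odd (x + y)) (List.product [0..<5] [0..<7])"
  have "star_check ?J grid_adj table_3_4 5"
    by code_simp
  moreover have "grid_edges 3 4 \<subseteq> set ?J"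
    by (auto simp: grid_edges_def)
  ultimately show ?thesis
    using star_colorable_check star_colorable_subset by blast
qed

text \<open>The adjacency of the two-row grid with \<open>y\<close> modulo 8, that is, period 4 in
  vertices; adding 7 or 6 subtracts 1 or 2. Rungs have \<open>x = 1\<close> and rails
  \<open>x = 0\<close> or \<open>x = 2\<close>, so \<open>x \<noteq> 1\<close> takes the place of
  \<open>odd y\<close>.\<close>

fun ladder_adj :: "nat \<times> nat \<Rightarrow> nat \<times> nat \<Rightarrow> bool" where
  "ladder_adj (x, y) (x', y') \<longleftrightarrow>
     (x = Suc x' \<or> x' = Suc x) \<and> (y' = (y + 1) mod 8 \<or> y' = (y + 7) mod 8) \<or>
     x \<noteq> 1 \<and> x = x' \<and> (y' = (y + 2) mod 8 \<or> y' = (y + 6) mod 8)"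

lemma mod_neq_if_close:
  fixes t u k :: nat
  assumes "t \<noteq> u" "t < u + k" "u < t + k"
  shows "t mod k \<noteq> u mod k"
proof
  assume "t mod k = u mod k"
  then have "k dvd t - u" "k dvd u - t"
    by (metis mod_eq_dvd_iff_nat dvd_0_right diff_is_0_eq nat_le_linear)+
  then show False
    using assms by (auto dest!: dvd_imp_le)
qed

lemma ladder_adj_mod:
  assumes "grid_adj (x, y) (x', y')" "odd (x + y)" "x < 3" "x' < 3"
  shows "ladder_adj (x, y mod 8) (x', y' mod 8)"
proof -
  have "odd x \<Longrightarrow> x < 3 \<Longrightarrow> x = 1" for x :: nat
    by presburger
  then show ?thesis
    using assms unfolding grid_adj.simps by (elim disjE conjE) (auto simp: mod_simps)
qed

lemma colorable_2: "star_colorable (grid_edges 2 n) grid_adj 4"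
proof -
  let ?J = "filter (\<lambda>(x, y). odd (x + y)) (List.product [0..<3] [0..<8])"
  \<comment> \<open>On each rail and on the rungs the four colors recur cyclically, with relative
    shifts 0, 1 and 3.\<close>
  let ?C = "\<lambda>(x, y). (y div 2 + [0, 1, 3] ! x) mod 4"
  have "star_check ?J ladder_adj ?C 4"
    by code_simp
  then have "star_colorable (set ?J) ladder_adj 4"
    by (rule star_colorable_check)
  then show ?thesis
  proof (rule star_colorable_pullback[where p = "\<lambda>(x, y). (x, y mod 8)"])
    fix e assume "e \<in> grid_edges 2 n"
    then show "(case e of (x, y) \<Rightarrow> (x, y mod 8)) \<in> set ?J"
      by (auto simp: grid_edges_def) presburger+
  next
    fix e f assume "e \<in> grid_edges 2 n" "f \<in> grid_edges 2 n" "grid_adj e f"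
    then show "ladder_adj (case e of (x, y) \<Rightarrow> (x, y mod 8)) (case f of (x, y) \<Rightarrow> (x, y mod 8))"
      using ladder_adj_mod by (auto simp: grid_edges_def simp del: grid_adj.simps ladder_adj.simps)
  next
    fix e q r assume adj: "grid_adj e q" "grid_adj q r" "e \<noteq> r"
    obtain a b x y c d where "e = (a, b)" "q = (x, y)" "r = (c, d)"
      by (cases e; cases q; cases r)
    \<comment> \<open>Both edges are adjacent to \<open>q\<close>, so their second coordinates
      differ by at most 4 and reduction modulo 8 cannot identify them.\<close>
    moreover from this have "b < d + 8" "d < b + 8"
      using adj by auto
    ultimately show "(case e of (x, y) \<Rightarrow> (x, y mod 8)) \<noteq> (case r of (x, y) \<Rightarrow> (x, y mod 8))"
      using adj(3) mod_neq_if_close by auto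
  qed
qed

text \<open>
  The image of \<^const>\<open>grid_adj\<close> under \<open>(x, y) \<mapsto> (x + 2 y) mod 16\<close>; the parity of the residue is that
  of \<open>x\<close>.
\<close>

definition circulant_adj :: "nat \<Rightarrow> nat \<Rightarrow> bool" where
  "circulant_adj t u \<longleftrightarrow>
     u \<in> set (map (\<lambda>d. (t + d) mod 16) (if odd t then [1, 2, 3, 13, 14, 15] else [1, 3, 4, 12, 13, 15]))"

text \<open>The table is symmetric: shifting the residue by 4 permutes the colors by the cycle 0, 3,
  1, 4 and the swap of 2 and 5.\<close>

definition circulant_coloring :: "nat \<Rightarrow> nat" where
  "circulant_coloring t = [0, 1, 0, 2, 3, 4, 3, 5, 1, 0, 1, 2, 4, 3, 4, 5] ! t"

lemma even_mod_16: "even (t mod 16) \<longleftrightarrow> even t" for t :: nat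
  by presburger

lemma circulant_adj_mod:
  assumes "grid_adj (x, y) (x', y')" "odd (x + y)"
  shows "circulant_adj ((x + 2 * y) mod 16) ((x' + 2 * y') mod 16)"
proof -
  define t u where "t = x + 2 * y" and "u = x' + 2 * y'"
  \<comment> \<open>Perpendicular neighbors change \<open>x + 2 * y\<close> by one of the four
    values of \<plusminus>1 \<plusminus> 2; collinear ones change it by \<plusminus>2 if
    \<open>x\<close> is odd and by \<plusminus>4 if \<open>y\<close> is odd.\<close>
  have "int u - int t \<in> {1, -1, 3, -3} \<or> odd t \<and> int u - int t \<in> {2, -2} \<or>
      even t \<and> int u - int t \<in> {4, -4}"
    using assms unfolding t_def u_def grid_adj.simps by (elim disjE conjE) simp_all
  then consider "u = t + 1" | "t = u + 1" | "u = t + 3" | "t = u + 3" | "odd t" "u = t + 2"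
    | "odd u" "t = u + 2" | "even t" "u = t + 4" | "even u" "t = u + 4"
    by (elim disjE conjE insertE emptyE) (atomize_elim, presburger)+
  then have "circulant_adj (t mod 16) (u mod 16)"
    by cases (simp_all add: circulant_adj_def mod_simps even_mod_16)
  then show ?thesis
    by (simp add: t_def u_def)
qed

lemma grid_adj_close:
  assumes "grid_adj (x, y) (x', y')" "odd (x + y)"
  shows "x + 2 * y < x' + 2 * y' + 8" "x' + 2 * y' < x + 2 * y + 8"
  using assms unfolding grid_adj.simps by (elim disjE conjE; simp)+

text \<open>The at most six neighbors of an edge shift \<open>x + 2 * y\<close> by different
  amounts: \<plusminus>1, \<plusminus>3 and, according to the direction of the edge, \<plusminus>2
  or \<plusminus>4.\<close>

lemma grid_adj_inj:
  assumes "grid_adj (x, y) (a, b)" "grid_adj (x, y) (c, d)" "odd (x + y)" "a + 2 * b = c + 2 * d"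
  shows "a = c \<and> b = d"
  using assms unfolding grid_adj.simps by (elim disjE conjE) simp_all
lemma colorable_6: "star_colorable (grid_edges m n) grid_adj 6"
proof -
  have "star_check [0..<16] circulant_adj circulant_coloring 6"
    by code_simp
  then have "star_colorable (set [0..<16]) circulant_adj 6"
    by (rule star_colorable_check)
  then show ?thesis
  proof (rule star_colorable_pullback[where p = "\<lambda>(x, y). (x + 2 * y) mod 16"])
    fix e assume "e \<in> grid_edges m n"
    then show "(case e of (x, y) \<Rightarrow> (x + 2 * y) mod 16) \<in> set [0..<16]"
      by (cases e) simp
  next
    fix e f assume "e \<in> grid_edges m n" "f \<in> grid_edges m n" "grid_adj e f"
    then show "circulant_adj (case e of (x, y) \<Rightarrow> (x + 2 * y) mod 16) (case f of (x, y) \<Rightarrow> (x + 2 * y) mod 16)"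
      using circulant_adj_mod by (auto simp: grid_edges_def simp del: grid_adj.simps)
  next
    fix e q r assume q: "q \<in> grid_edges m n" and adj: "grid_adj e q" "grid_adj q r" "e \<noteq> r"
    obtain a b x y c d where eqs: "e = (a, b)" "q = (x, y)" "r = (c, d)"
      by (cases e; cases q; cases r)
    have odd: "odd (x + y)"
      using q by (simp add: eqs grid_edges_def)
    have xy: "grid_adj (x, y) (a, b)" "grid_adj (x, y) (c, d)"
      using adj grid_adj_sym by (simp_all only: eqs)
    have "a + 2 * b \<noteq> c + 2 * d"
      using grid_adj_inj[OF xy odd] adj(3) by (auto simp: eqs)
    \<comment> \<open>Each value is less than 8 away from that of \<open>q\<close>, so the two are
      less than 16 apart and remain distinct modulo 16.\<close>
    moreover have "a + 2 * b < (c + 2 * d) + 16" "c + 2 * d < (a + 2 * b) + 16"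
      using grid_adj_close[OF xy(1) odd] grid_adj_close[OF xy(2) odd] by linarith+
    ultimately show "(case e of (x, y) \<Rightarrow> (x + 2 * y) mod 16) \<noteq> (case r of (x, y) \<Rightarrow> (x + 2 * y) mod 16)"
      using mod_neq_if_close by (simp add: eqs)
  qed
qed

section \<open>Transposition, subgrids and the case distinction\<close>

lemma grid_adj_swap: "grid_adj (x, y) (x', y') \<Longrightarrow> grid_adj (y, x) (y', x')"
  unfolding grid_adj.simps by (elim disjE conjE) simp_all

lemma star_colorable_swap:
  assumes "star_colorable (grid_edges n m) grid_adj k"
  shows "star_colorable (grid_edges m n) grid_adj k"
  using assms
  by (rule star_colorable_pullback[where p = prod.swap])
    (auto simp: grid_edges_def grid_adj_swap simp del: grid_adj.simps)

lemma star_colorable_grid_mono: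
  assumes "star_colorable (grid_edges m n) grid_adj k" "m' \<le> m" "n' \<le> n"
  shows "star_colorable (grid_edges m' n') grid_adj k"
  by (rule star_colorable_subset[OF assms(1)]) (use assms(2,3) in \<open>auto simp: grid_edges_def\<close>)

lemma star_chromatic_index_gridI:
  assumes "star_colorable (grid_edges m n) grid_adj (Suc k)" "\<not> star_colorable (grid_edges m n) grid_adj k"
  shows "star_chromatic_index (path_graph m \<box> path_graph n) = Suc k"
  unfolding star_chromatic_index_grid
proof (rule Least_equality)
  show "star_colorable (grid_edges m n) grid_adj (Suc k)"
    by (fact assms(1))
  fix l assume "star_colorable (grid_edges m n) grid_adj l"
  then show "Suc k \<le> l"
    using assms(2) star_colorable_mono by (metis not_less_eq_eq)
qed

theorem theorem6:
  fixes m n :: nat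
  assumes "m \<ge> 2" and "n \<ge> 2"
  shows "star_chromatic_index (path_graph m \<box> path_graph n) =
    (if m = 2 \<and> n = 2 then 3
     else if (m = 2 \<and> n \<ge> 3) \<or> (m \<ge> 3 \<and> n = 2) then 4
     else if (m \<in> {3, 4} \<and> n = 3) \<or> (m = 3 \<and> n \<in> {3, 4}) then 5
     else 6)"
proof -
  let ?P = "\<lambda>m n k. star_colorable (grid_edges m n) grid_adj k"
  \<comment> \<open>A grid inherits the lower bound of any smaller grid that fits into it, possibly
    after transposition.\<close>
  have lower: "\<not> ?P m n k" if "\<not> ?P a b k" "a \<le> m \<and> b \<le> n \<or> a \<le> n \<and> b \<le> m" for a b k
    using that star_colorable_grid_mono star_colorable_swap by blast
  consider "m = 2" "n = 2" | "m = 2 \<and> n \<ge> 3 \<or> m \<ge> 3 \<and> n = 2"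
    | "m \<in> {3, 4} \<and> n = 3 \<or> m = 3 \<and> n \<in> {3, 4}"
    | "m \<ge> 3 \<and> n \<ge> 5 \<or> m \<ge> 5 \<and> n \<ge> 3 \<or> m \<ge> 4 \<and> n \<ge> 4"
    using assms by atomize_elim (simp, presburger)
  then show ?thesis
  proof cases
    case 1
    have "star_chromatic_index (path_graph m \<box> path_graph n) = Suc 2"
      by (rule star_chromatic_index_gridI) (use 1 colorable_2_2 not_colorable_2_2 in simp_all)
    then show ?thesis
      using 1 by simp
  next
    case 2
    have "star_chromatic_index (path_graph m \<box> path_graph n) = Suc 3"
    proof (rule star_chromatic_index_gridI)
      show "?P m n (Suc 3)"
        using 2 colorable_2 star_colorable_swap by auto
      show "\<not> ?P m n 3"
        using 2 lower[OF not_colorable_2_3] by auto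
    qed
    then show ?thesis
      using 2 by auto
  next
    case 3
    have "star_chromatic_index (path_graph m \<box> path_graph n) = Suc 4"
    proof (rule star_chromatic_index_gridI)
      have "m \<le> 3 \<and> n \<le> 4 \<or> n \<le> 3 \<and> m \<le> 4"
        using 3 by auto
      then have "?P m n 5"
        using colorable_3_4 star_colorable_swap star_colorable_grid_mono by blast
      then show "?P m n (Suc 4)"
        by simp
      show "\<not> ?P m n 4"
        using 3 lower[OF not_colorable_3_3] by auto
    qed
    then show ?thesis
      using 3 by auto
  next
    case 4
    have "star_chromatic_index (path_graph m \<box> path_graph n) = Suc 5"
    proof (rule star_chromatic_index_gridI)
      show "?P m n (Suc 5)"
        using colorable_6 by simp
      show "\<not> ?P m n 5"
        using 4 lower[OF not_colorable_3_5] lower[OF not_colorable_4_4] by auto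
    qed
    then show ?thesis
      using 4 by auto
  qed
qed

end
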